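(* Let $G$ be a simple biorientable graph. The subspaces of $\mathcal{P}_n$ given by $$P_n^{(l)}=\bigoplus_{i_1<i_2<\cdots\le n-2}c_{i_1}^\dagger c_{i_2}^\dagger\cdots c_{i_l}^\dagger(\mathcal{E}_{n-2l}),\qquad P_n^{(0)}=\mathcal{E}_n,\qquad l=0,\dots,[n/2],$$ are mutually orthogonal.
   Context: $G$ has $N_v$ vertices and $M$ is its $N_v\times N_v$ adjacency matrix. $\beta$ is the greatest eigenvalue of $M$ and $\mu=(\mu_v)$ is the Perron–Frobenius eigenvector, i.e. the eigenvector of $M$ with eigenvalue $\beta$, normalized so that its smallest component is $1$. An elementary path of length $n$ is a sequence $(v_0,\dots,v_n)$ of vertices of $G$ with consecutive ones adjacent. $\mathcal{P}_n$ is the inner product vector space with the elementary paths of length $n$ as orthonormal basis. The linear maps $c_i:\mathcal{P}_n\to\mathcal{P}_{n-2}$ and $c_i^\dagger:\mathcal{P}_n\to\mathcal{P}_{n+2}$ are $$c_i(v_0,\dots,v_n)=\delta_{v_iv_{i+2}}\sqrt{\mu_{v_{i+1}}/\mu_{v_i}}\,(v_0,\dots,v_i,v_{i+3},\dots,v_n)\ \text{ if }0\le i\le n-2,\ 0\text{ otherwise},$$ $$c_i^\dagger(v_0,\dots,v_n)=\sum_{v\sim v_i}\sqrt{\mu_v/\mu_{v_i}}\,(v_0,\dots,v_i,v,v_i,v_{i+1},\dots,v_n)\ \text{ if }0\le i\le n,\ 0\text{ otherwise}$$ (sum over vertices $v$ adjacent to $v_i$). Essential paths: $\mathcal{E}_n=\{\xi\in\mathcal{P}_n: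 c_i\xi=0,\ i=0,\dots,n-2\}$. $[\cdot]$ denotes the integer part. *)

theory Defs
  imports
    Complex_Main
    "HOL-Library.Poly_Mapping"
    "Graph_Theory.Digraph"
    "Graph_Theory.Vertex_Walk"
    "Jordan_Normal_Form.Char_Poly"
begin

text \<open>
  The locale \<^locale>\<open>graph\<close> describes finite digraphs without loops and without multiple arcs
  in which every arc has a reverse arc, that is, simple biorientable graphs.
\<close>

text \<open>The vertices are enumerated by a list \<open>vs\<close>, which indexes the rows and columns.\<close>

definition adjacency_matrix :: "('a, 'b) pre_digraph \<Rightarrow> 'a list \<Rightarrow> real mat" where
  "adjacency_matrix G vs =
     mat (length vs) (length vs) (\<lambda>(i, j). if vs ! i \<rightarrow>\<^bsub>G\<^esub> vs ! j then 1 else 0)"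

definition greatest_eigenvalue :: "real mat \<Rightarrow> real \<Rightarrow> bool" where
  "greatest_eigenvalue A \<beta> \<longleftrightarrow> eigenvalue A \<beta> \<and> (\<forall>k. eigenvalue A k \<longrightarrow> k \<le> \<beta>)"

text \<open>
  If the graph is connected, exactly one family \<open>\<mu>\<close> (on the vertices) satisfies this predicate;
  connectedness itself is not required.
\<close>

definition perron_frobenius_eigenvector ::
    "('a, 'b) pre_digraph \<Rightarrow> 'a list \<Rightarrow> real \<Rightarrow> ('a \<Rightarrow> real) \<Rightarrow> bool" where
  "perron_frobenius_eigenvector G vs \<beta> \<mu> \<longleftrightarrow>
     greatest_eigenvalue (adjacency_matrix G vs) \<beta> \<and>
     eigenvector (adjacency_matrix G vs) (vec_of_list (map \<mu> vs)) \<beta> \<and>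
     Min (\<mu> ` verts G) = 1"

definition elementary_paths :: "('a, 'b) pre_digraph \<Rightarrow> nat \<Rightarrow> 'a list set" where
  "elementary_paths G n = {p. vwalk p G \<and> vwalk_length p = n}"

text \<open>
  Vectors are finitely supported complex functions on vertex sequences.  The space of paths of
  length \<open>n\<close> consists of those supported on the elementary paths of length \<open>n\<close>, with
  \<open>Poly_Mapping.single p 1\<close> as the basis vector of the path \<open>p\<close>.
\<close>

type_synonym 'a path_vec = "'a list \<Rightarrow>\<^sub>0 complex"

definition path_space :: "('a, 'b) pre_digraph \<Rightarrow> nat \<Rightarrow> 'a path_vec set" where
  "path_space G n = {\<xi>. Poly_Mapping.keys \<xi> \<subseteq> elementary_paths G n}"

definition path_inner :: "'a path_vec \<Rightarrow> 'a path_vec \<Rightarrow> complex" where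
  "path_inner \<xi> \<eta> =
     (\<Sum>p\<in>Poly_Mapping.keys \<xi>. cnj (Poly_Mapping.lookup \<xi> p) * Poly_Mapping.lookup \<eta> p)"

definition linear_extension :: "('a list \<Rightarrow> 'a path_vec) \<Rightarrow> 'a path_vec \<Rightarrow> 'a path_vec" where
  "linear_extension f \<xi> =
     (\<Sum>p\<in>Poly_Mapping.keys \<xi>. Poly_Mapping.map ((*) (Poly_Mapping.lookup \<xi> p)) (f p))"

text \<open>
  The operators act on all lengths at once: a path \<open>p = [v\<^sub>0, \<dots>, v\<^sub>n]\<close> carries its own
  length \<open>n = length p - 1\<close>, so that \<open>i \<le> n - 2\<close> reads \<open>i + 2 < length p\<close> and \<open>i \<le> n\<close> reads
  \<open>i < length p\<close>.
\<close>

definition annihilation_basis :: "('a \<Rightarrow> real) \<Rightarrow> nat \<Rightarrow> 'a list \<Rightarrow> 'a path_vec" where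
  "annihilation_basis \<mu> i p =
     (if i + 2 < length p \<and> p ! i = p ! (i + 2)
      then Poly_Mapping.single (take (i + 1) p @ drop (i + 3) p)
             (complex_of_real (sqrt (\<mu> (p ! (i + 1)) / \<mu> (p ! i))))
      else 0)"

definition creation_basis ::
    "('a, 'b) pre_digraph \<Rightarrow> ('a \<Rightarrow> real) \<Rightarrow> nat \<Rightarrow> 'a list \<Rightarrow> 'a path_vec" where
  "creation_basis G \<mu> i p =
     (if i < length p
      then \<Sum>v | v \<rightarrow>\<^bsub>G\<^esub> (p ! i).
             Poly_Mapping.single (take (i + 1) p @ v # drop i p)
               (complex_of_real (sqrt (\<mu> v / \<mu> (p ! i))))
      else 0)"

definition annihilation :: "('a \<Rightarrow> real) \<Rightarrow> nat \<Rightarrow> 'a path_vec \<Rightarrow> 'a path_vec" where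
  "annihilation \<mu> i = linear_extension (annihilation_basis \<mu> i)"

definition creation ::
    "('a, 'b) pre_digraph \<Rightarrow> ('a \<Rightarrow> real) \<Rightarrow> nat \<Rightarrow> 'a path_vec \<Rightarrow> 'a path_vec" where
  "creation G \<mu> i = linear_extension (creation_basis G \<mu> i)"

definition essential_paths ::
    "('a, 'b) pre_digraph \<Rightarrow> ('a \<Rightarrow> real) \<Rightarrow> nat \<Rightarrow> 'a path_vec set" where
  "essential_paths G \<mu> n = {\<xi> \<in> path_space G n. \<forall>i. i + 2 \<le> n \<longrightarrow> annihilation \<mu> i \<xi> = 0}"

definition creation_indices :: "nat \<Rightarrow> nat \<Rightarrow> nat list set" where
  "creation_indices n l = {is. length is = l \<and> sorted_wrt (<) is \<and> (\<forall>i\<in>set is. i + 2 \<le> n)}"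

text \<open>
  The sum over index lists \<open>[i\<^sub>1, \<dots>, i\<^sub>l]\<close> of the images of the essential paths of length
  \<open>n - 2 l\<close>; \<open>foldr\<close> applies the creation operator of \<open>i\<^sub>l\<close> first and that of \<open>i\<^sub>1\<close> last.
  The summands need not be independent: on the graph with two vertices and one edge,
  \<open>n = 3\<close> and \<open>l = 1\<close> give two equal nonzero summands.
\<close>

definition path_layer ::
    "('a, 'b) pre_digraph \<Rightarrow> ('a \<Rightarrow> real) \<Rightarrow> nat \<Rightarrow> nat \<Rightarrow> 'a path_vec set" where
  "path_layer G \<mu> n l =
     {\<Sum>is\<in>creation_indices n l. \<eta> is | \<eta>.
        \<forall>is\<in>creation_indices n l. \<eta> is \<in> foldr (creation G \<mu>) is ` essential_paths G \<mu> (n - 2 * l)}"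

lemma path_layer_0: "path_layer G \<mu> n 0 = essential_paths G \<mu> n"
proof -
  have "creation_indices n 0 = {[]}"
    by (auto simp: creation_indices_def)
  then show ?thesis
    by (auto simp: path_layer_def intro: exI[of _ "\<lambda>_. x" for x])
qed

end

theory Submission
  imports Defs
begin

text \<open>
  On walks the operators satisfy the Temperley-Lieb type relations: an annihilation operator
  followed past a creation operator either cancels it (up to a scalar) or moves past it.
  Hence applying more annihilation operators than there are creation operators in front of an
  essential path gives \<open>0\<close>.  As creation is adjoint to annihilation, the inner product of elements
  of two layers is the inner product of an essential path with such a vector.
\<close>

section \<open>Scaling and linear extension\<close>

abbreviation scale :: "complex \<Rightarrow> 'a path_vec \<Rightarrow> 'a path_vec" where
  "scale c \<equiv> Poly_Mapping.map ((*) c)"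

lemma lookup_scale [simp]: "Poly_Mapping.lookup (scale c \<xi>) p = c * Poly_Mapping.lookup \<xi> p"
  by (simp add: Poly_Mapping.map.rep_eq when_def)

lemma scale_single [simp]: "scale c (Poly_Mapping.single p x) = Poly_Mapping.single p (c * x)"
  by (rule poly_mapping_eqI) (simp add: Poly_Mapping.lookup_single when_def)

lemma scale_zero_left [simp]: "scale 0 \<xi> = 0"
  by (rule poly_mapping_eqI) simp

lemma scale_zero_right [simp]: "scale c 0 = 0"
  by (rule poly_mapping_eqI) simp

lemma scale_sum: "scale c (\<Sum>x\<in>A. f x) = (\<Sum>x\<in>A. scale c (f x))"
  by (rule poly_mapping_eqI) (simp add: lookup_sum sum_distrib_left)

lemma single_sum: "Poly_Mapping.single p (\<Sum>x\<in>A. f x) = (\<Sum>x\<in>A. Poly_Mapping.single p (f x))"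
  by (induction A rule: infinite_finite_induct) (simp_all add: single_add)

lemma lookup_linear_extension:
  assumes "finite S" "Poly_Mapping.keys \<xi> \<subseteq> S"
  shows "Poly_Mapping.lookup (linear_extension f \<xi>) q =
    (\<Sum>p\<in>S. Poly_Mapping.lookup \<xi> p * Poly_Mapping.lookup (f p) q)"
proof -
  have "Poly_Mapping.lookup (linear_extension f \<xi>) q =
      (\<Sum>p\<in>Poly_Mapping.keys \<xi>. Poly_Mapping.lookup \<xi> p * Poly_Mapping.lookup (f p) q)"
    by (simp add: linear_extension_def lookup_sum)
  also have "\<dots> = (\<Sum>p\<in>S. Poly_Mapping.lookup \<xi> p * Poly_Mapping.lookup (f p) q)"
    using assms by (intro sum.mono_neutral_left) (auto simp: in_keys_iff)
  finally show ?thesis .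
qed

lemma linear_extension_add:
  "linear_extension f (\<xi> + \<eta>) = linear_extension f \<xi> + linear_extension f \<eta>"
proof (rule poly_mapping_eqI)
  fix q
  let ?S = "Poly_Mapping.keys \<xi> \<union> Poly_Mapping.keys \<eta>"
  show "Poly_Mapping.lookup (linear_extension f (\<xi> + \<eta>)) q =
      Poly_Mapping.lookup (linear_extension f \<xi> + linear_extension f \<eta>) q"
    using Poly_Mapping.keys_add[of \<xi> \<eta>]
    by (simp add: lookup_add lookup_linear_extension[of ?S] sum.distrib algebra_simps)
qed

lemma linear_extension_scale:
  "linear_extension f (scale c \<xi>) = scale c (linear_extension f \<xi>)"
proof (rule poly_mapping_eqI)
  fix q
  have "Poly_Mapping.keys (scale c \<xi>) \<subseteq> Poly_Mapping.keys \<xi>"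
    by (auto simp: in_keys_iff)
  then show "Poly_Mapping.lookup (linear_extension f (scale c \<xi>)) q =
      Poly_Mapping.lookup (scale c (linear_extension f \<xi>)) q"
    by (simp add: lookup_linear_extension[of "Poly_Mapping.keys \<xi>"] sum_distrib_left mult.assoc)
qed

lemma linear_extension_zero [simp]: "linear_extension f 0 = 0"
  by (simp add: linear_extension_def)

lemma linear_extension_sum:
  "linear_extension f (\<Sum>x\<in>A. g x) = (\<Sum>x\<in>A. linear_extension f (g x))"
  by (induction A rule: infinite_finite_induct) (simp_all add: linear_extension_add)

lemma linear_extension_single [simp]:
  "linear_extension f (Poly_Mapping.single p c) = scale c (f p)"
  by (simp add: linear_extension_def)

text \<open>Reduces an identity between products of operators to one on single paths;
  \<open>linear_extension_cong\<close> then restricts it to the support, which for elements of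
  \<open>path_space\<close> consists of walks.\<close>

lemma linear_extension_linear_extension:
  "linear_extension f (linear_extension g \<xi>) = linear_extension (\<lambda>p. linear_extension f (g p)) \<xi>"
  by (simp add: linear_extension_def[of g] linear_extension_def[of _ \<xi>] linear_extension_sum
      linear_extension_scale)

lemma linear_extension_cong:
  assumes "\<And>p. p \<in> Poly_Mapping.keys \<xi> \<Longrightarrow> f p = g p"
  shows "linear_extension f \<xi> = linear_extension g \<xi>"
  unfolding linear_extension_def by (intro sum.cong) (simp_all add: assms)

lemma linear_extension_scaled_basis:
  "linear_extension (\<lambda>p. Poly_Mapping.single p c) \<xi> = scale c \<xi>"
proof (rule poly_mapping_eqI)
  fix q
  show "Poly_Mapping.lookup (linear_extension (\<lambda>p. Poly_Mapping.single p c) \<xi>) q =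
      Poly_Mapping.lookup (scale c \<xi>) q"
    by (simp add: lookup_linear_extension[of "Poly_Mapping.keys \<xi>"] Poly_Mapping.lookup_single
        when_def in_keys_iff if_distrib[of "(*) _"] cong: if_cong)
qed

section \<open>The inner product\<close>

lemma path_inner_eq:
  assumes "finite S" "Poly_Mapping.keys \<xi> \<subseteq> S"
  shows "path_inner \<xi> \<eta> = (\<Sum>p\<in>S. cnj (Poly_Mapping.lookup \<xi> p) * Poly_Mapping.lookup \<eta> p)"
  unfolding path_inner_def using assms by (intro sum.mono_neutral_left) (auto simp: in_keys_iff)

lemma path_inner_zero_right [simp]: "path_inner \<xi> 0 = 0"
  by (simp add: path_inner_def)

lemma path_inner_zero_left [simp]: "path_inner 0 \<eta> = 0"
  by (simp add: path_inner_def)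

lemma path_inner_add_right: "path_inner \<xi> (\<eta> + \<zeta>) = path_inner \<xi> \<eta> + path_inner \<xi> \<zeta>"
  by (simp add: path_inner_def lookup_add algebra_simps sum.distrib)

lemma path_inner_commute: "path_inner \<eta> \<xi> = cnj (path_inner \<xi> \<eta>)"
  by (simp add: path_inner_eq[of "Poly_Mapping.keys \<xi> \<union> Poly_Mapping.keys \<eta>"] mult.commute)

text \<open>Both sides are one double sum over the two supports, taken in either order. Only matrix
  entries on the supports are compared, since creation and annihilation need not be adjoint on
  sequences that are not walks.\<close>

lemma path_inner_linear_extension_right:
  assumes "\<And>p q. p \<in> Poly_Mapping.keys \<xi> \<Longrightarrow> q \<in> Poly_Mapping.keys \<eta> \<Longrightarrow>
    Poly_Mapping.lookup (f q) p = cnj (Poly_Mapping.lookup (g p) q)"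
  shows "path_inner \<xi> (linear_extension f \<eta>) = path_inner (linear_extension g \<xi>) \<eta>"
proof -
  let ?X = "Poly_Mapping.keys \<xi>" and ?Y = "Poly_Mapping.keys \<eta>"
  let ?x = "Poly_Mapping.lookup \<xi>" and ?y = "Poly_Mapping.lookup \<eta>"
  have "path_inner \<xi> (linear_extension f \<eta>) =
      (\<Sum>p\<in>?X. \<Sum>q\<in>?Y. cnj (?x p) * (?y q * Poly_Mapping.lookup (f q) p))"
    by (simp add: path_inner_def lookup_linear_extension[of ?Y] sum_distrib_left)
  also have "\<dots> = (\<Sum>p\<in>?X. \<Sum>q\<in>?Y. cnj (?x p) * (?y q * cnj (Poly_Mapping.lookup (g p) q)))"
    by (intro sum.cong refl) (simp add: assms)
  also have "\<dots> = (\<Sum>q\<in>?Y. \<Sum>p\<in>?X. cnj (?x p) * (?y q * cnj (Poly_Mapping.lookup (g p) q)))"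
    by (rule sum.swap)
  also have "\<dots> = cnj (path_inner \<eta> (linear_extension g \<xi>))"
    by (simp add: path_inner_def lookup_linear_extension[of ?X] sum_distrib_left mult_ac)
  finally show ?thesis by (simp add: path_inner_commute[symmetric])
qed

section \<open>Relations between creation and annihilation\<close>

lemma vwalk_append_Cons_Cons:
  "vwalk (xs @ a # b # ys) G \<longleftrightarrow> vwalk (xs @ [a]) G \<and> (a, b) \<in> arcs_ends G \<and> vwalk (b # ys) G"
proof (induction xs)
  case Nil
  then show ?case by (auto simp: vwalk_def)
next
  case (Cons x xs)
  then show ?case by (cases xs) (auto simp: vwalk_def)
qed

lemma vwalk_appendD:
  assumes "vwalk (xs @ a # ys) G"
  shows "vwalk (xs @ [a]) G" "vwalk (a # ys) G"
proof -
  have "vwalk (xs @ [a]) G \<and> vwalk (a # ys) G"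
  proof (cases ys)
    case Nil
    with assms show ?thesis by (simp add: vwalk_def)
  next
    case (Cons b zs)
    have "a \<in> verts G" using assms by (simp add: vwalk_def)
    then show ?thesis
      using assms vwalk_append_Cons_Cons[of xs a b zs G] vwalk_append_Cons_Cons[of "[]" a b zs G]
      by (simp add: Cons vwalk_def)
  qed
  then show "vwalk (xs @ [a]) G" "vwalk (a # ys) G" by simp_all
qed

text \<open>Writing the position as the length of a prefix replaces index arithmetic by the shape of
  the list. \<open>split_list_at\<close> and \<open>split_list_at_3\<close> bring a path into this
  shape.\<close>

lemma annihilation_basis_append:
  "annihilation_basis \<mu> (length xs) (xs @ a # b # c # ys) =
     (if a = c then Poly_Mapping.single (xs @ a # ys) (complex_of_real (sqrt (\<mu> b / \<mu> a))) else 0)"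
  by (simp add: annihilation_basis_def nth_append)

lemma annihilation_basis_out_of_range:
  "length p \<le> i + 2 \<Longrightarrow> annihilation_basis \<mu> i p = 0"
  by (simp add: annihilation_basis_def)

lemma creation_basis_append:
  "creation_basis G \<mu> (length xs) (xs @ a # ys) =
     (\<Sum>v | v \<rightarrow>\<^bsub>G\<^esub> a. Poly_Mapping.single (xs @ a # v # a # ys) (complex_of_real (sqrt (\<mu> v / \<mu> a))))"
  by (simp add: creation_basis_def nth_append)

lemma creation_basis_out_of_range:
  "length p \<le> i \<Longrightarrow> creation_basis G \<mu> i p = 0"
  by (simp add: creation_basis_def)

lemma split_list_at:
  assumes "i < length p"
  obtains xs a ys where "p = xs @ a # ys" "length xs = i"
  using that[of "take i p" "p ! i" "drop (Suc i) p"] assms by (simp add: id_take_nth_drop[symmetric])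

lemma split_list_at_3:
  assumes "i + 2 < length p"
  obtains xs a b c ys where "p = xs @ a # b # c # ys" "length xs = i"
proof -
  have "drop i p = p ! i # p ! (i + 1) # p ! (i + 2) # drop (i + 3) p"
    using assms by (simp add: Cons_nth_drop_Suc numeral_eq_Suc)
  then show ?thesis
    using that[of "take i p" "p ! i" "p ! (i + 1)" "p ! (i + 2)" "drop (i + 3) p"] assms
    by (metis append_take_drop_id length_take min.absorb4 add_lessD1)
qed

text \<open>Creation at \<open>i\<close> pushes all later vertices two places on, so the triple
  tested at \<open>j\<close> is the one that stood at \<open>j - 2\<close>. The two operations meet
  in at most one vertex, and their weights multiply in either order.\<close>

lemma annihilation_creation_basis_right:
  assumes "i + 2 \<le> j"
  shows "annihilation \<mu> j (creation_basis G \<mu> i p) = creation G \<mu> i (annihilation_basis \<mu> (j - 2) p)"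
proof (cases "j < length p")
  case True
  then have "j - 2 + 2 < length p" using assms by simp
  then obtain xs d b c ys where p: "p = xs @ d # b # c # ys" and xs: "length xs = j - 2"
    by (rule split_list_at_3)
  show ?thesis
  \<comment> \<open>For \<open>i = j - 2\<close> the doubled vertex is \<open>d\<close>, and the
    triple begins with its second copy; otherwise the doubled vertex lies inside
    \<open>xs\<close>.\<close>
  proof (cases "i = j - 2")
    case True
    have ann: "annihilation_basis \<mu> j (xs @ d # v # d # b # c # ys) =
        (if d = c then Poly_Mapping.single (xs @ d # v # d # ys) (complex_of_real (sqrt (\<mu> b / \<mu> d))) else 0)" for v
    proof -
      have "length (xs @ [d, v]) = j" using xs assms by simp
      then show ?thesis using annihilation_basis_append[of \<mu> "xs @ [d, v]" d b c ys] by simp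
    qed
    have ann': "annihilation_basis \<mu> (j - 2) p =
        (if d = c then Poly_Mapping.single (xs @ d # ys) (complex_of_real (sqrt (\<mu> b / \<mu> d))) else 0)"
      using annihilation_basis_append[of \<mu> xs d b c ys] by (simp add: p xs)
    have cre: "creation_basis G \<mu> i (xs @ e # zs) =
        (\<Sum>v | v \<rightarrow>\<^bsub>G\<^esub> e. Poly_Mapping.single (xs @ e # v # e # zs) (complex_of_real (sqrt (\<mu> v / \<mu> e))))" for e zs
      using creation_basis_append[of G \<mu> xs e zs] True xs by simp
    show ?thesis
      unfolding ann' unfolding p
      by (simp add: cre annihilation_def creation_def linear_extension_sum ann scale_sum
          mult.commute)
  next
    case False
    then have "i < length xs" using assms xs by simp
    then obtain us a zs where us: "xs = us @ a # zs" and i: "length us = i"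
      by (rule split_list_at)
    have ann: "annihilation_basis \<mu> j (us @ a # v # a # zs @ d # b # c # ys) =
        (if d = c then Poly_Mapping.single (us @ a # v # a # zs @ d # ys) (complex_of_real (sqrt (\<mu> b / \<mu> d))) else 0)" for v
    proof -
      have "length (us @ a # v # a # zs) = j" using xs us assms by simp
      then show ?thesis
        using annihilation_basis_append[of \<mu> "us @ a # v # a # zs" d b c ys] by simp
    qed
    have ann': "annihilation_basis \<mu> (j - 2) (us @ a # zs @ d # b # c # ys) =
        (if d = c then Poly_Mapping.single (us @ a # zs @ d # ys) (complex_of_real (sqrt (\<mu> b / \<mu> d))) else 0)"
      using annihilation_basis_append[of \<mu> "us @ a # zs" d b c ys] xs us assms by simp
    show ?thesis
      unfolding p us i[symmetric]
      by (simp add: ann ann' creation_basis_append annihilation_def creation_def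
          linear_extension_sum scale_sum mult.commute)
  qed
next
  case False
  then have "annihilation_basis \<mu> (j - 2) p = 0"
    using assms by (intro annihilation_basis_out_of_range) simp
  moreover have "annihilation \<mu> j (creation_basis G \<mu> i p) = 0"
    using False assms
    by (auto simp: annihilation_def creation_basis_def linear_extension_sum
        annihilation_basis_out_of_range)
  ultimately show ?thesis by (simp add: creation_def)
qed

text \<open>Mirror image: contracting the triple at \<open>j\<close> pulls position \<open>i\<close>
  back by two, so creation must afterwards act at \<open>i - 2\<close>.\<close>

lemma annihilation_creation_basis_left:
  assumes "j + 2 \<le> i"
  shows "annihilation \<mu> j (creation_basis G \<mu> i p) = creation G \<mu> (i - 2) (annihilation_basis \<mu> j p)"
proof (cases "i < length p")
  case True
  then have "j + 2 < length p" using assms by simp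
  then obtain xs d b c ys where p: "p = xs @ d # b # c # ys" and xs: "length xs = j"
    by (rule split_list_at_3)
  show ?thesis
  \<comment> \<open>For \<open>i = j + 2\<close> the left side doubles the last vertex
    \<open>c\<close> of the triple and the right side doubles \<open>d\<close>; they agree because
    nothing survives unless \<open>d = c\<close>.\<close>
  proof (cases "i = j + 2")
    case True
    have cre: "creation_basis G \<mu> i (xs @ d # b # c # ys) =
        (\<Sum>v | v \<rightarrow>\<^bsub>G\<^esub> c. Poly_Mapping.single (xs @ d # b # c # v # c # ys) (complex_of_real (sqrt (\<mu> v / \<mu> c))))"
      using creation_basis_append[of G \<mu> "xs @ [d, b]" c ys] xs True by simp
    show ?thesis
      unfolding p cre using xs True
      by (auto simp: annihilation_basis_append creation_basis_append annihilation_def creation_def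
          linear_extension_sum scale_sum mult.commute)
  next
    case False
    then have "i - (j + 3) < length ys" using assms xs True p by simp
    then obtain us a zs where us: "ys = us @ a # zs" and i: "length us = i - (j + 3)"
      by (rule split_list_at)
    have cre: "creation_basis G \<mu> i (xs @ d # b # c # us @ a # zs) =
        (\<Sum>v | v \<rightarrow>\<^bsub>G\<^esub> a. Poly_Mapping.single (xs @ d # b # c # us @ a # v # a # zs) (complex_of_real (sqrt (\<mu> v / \<mu> a))))"
    proof -
      have "length (xs @ d # b # c # us) = i" using xs i assms False by simp
      then show ?thesis using creation_basis_append[of G \<mu> "xs @ d # b # c # us" a zs] by simp
    qed
    have cre': "creation_basis G \<mu> (i - 2) (xs @ e # us @ a # zs) =
        (\<Sum>v | v \<rightarrow>\<^bsub>G\<^esub> a. Poly_Mapping.single (xs @ e # us @ a # v # a # zs) (complex_of_real (sqrt (\<mu> v / \<mu> a))))" for e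
    proof -
      have "length (xs @ e # us) = i - 2" using xs i assms False by simp
      then show ?thesis using creation_basis_append[of G \<mu> "xs @ e # us" a zs] by simp
    qed
    show ?thesis
      unfolding p us cre using xs
      by (auto simp: annihilation_basis_append cre' annihilation_def creation_def
          linear_extension_sum scale_sum mult.commute)
  qed
next
  case False
  \<comment> \<open>If the contraction on the right is nonzero, its path is two vertices shorter, so
    \<open>i - 2\<close> lies beyond its end.\<close>
  then show ?thesis
    using assms
    by (auto simp: annihilation_def creation_def creation_basis_out_of_range annihilation_basis_def)
qed

text \<open>Isolates the positivity and the eigenvector equation of the Perron-Frobenius weights.
  The sum runs over arcs into \<open>v\<close>, matching the range of summation in
  \<open>creation_basis\<close>.\<close>

locale weighted_graph = graph G for G :: "('a, 'b) pre_digraph" +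
  fixes \<mu> :: "'a \<Rightarrow> real" and \<beta> :: real
  assumes weight_pos: "v \<in> verts G \<Longrightarrow> 0 < \<mu> v"
    and weight_sum: "v \<in> verts G \<Longrightarrow> (\<Sum>w | w \<rightarrow>\<^bsub>G\<^esub> v. \<mu> w) = \<beta> * \<mu> v"
begin

section \<open>Annihilation after creation at equal or neighbouring positions\<close>

lemma arc_sym: "u \<rightarrow>\<^bsub>G\<^esub> v \<Longrightarrow> v \<rightarrow>\<^bsub>G\<^esub> u"
  using sym_arcs by (rule arcs_ends_symmetric)

lemma finite_neighbours: "finite {v. v \<rightarrow>\<^bsub>G\<^esub> a}"
  by (rule finite_subset[OF _ finite_verts]) (auto intro: adj_in_verts)

text \<open>Gives the coefficient one in the two relations for neighbouring positions.\<close>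

lemma sqrt_weight_mult:
  assumes "u \<in> verts G" "v \<in> verts G"
  shows "complex_of_real (sqrt (\<mu> u / \<mu> v)) * complex_of_real (sqrt (\<mu> v / \<mu> u)) = 1"
  using weight_pos[OF assms(1)] weight_pos[OF assms(2)]
  by (simp flip: of_real_mult real_sqrt_mult)

text \<open>Each inserted detour is removed again with its weight squared, so the coefficient is the
  sum of \<open>\<mu> v / \<mu> a\<close> over the neighbours \<open>v\<close> of the vertex
  \<open>a\<close> at position \<open>i\<close>; the eigenvector equation evaluates it to
  \<open>\<beta>\<close>.\<close>

lemma annihilation_creation_basis_same:
  assumes "vwalk p G"
  shows "annihilation \<mu> i (creation_basis G \<mu> i p) =
    Poly_Mapping.single p (if i < length p then complex_of_real \<beta> else 0)"
proof (cases "i < length p")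
  case True
  then obtain xs a ys where p: "p = xs @ a # ys" and i: "length xs = i"
    by (rule split_list_at)
  have a: "a \<in> verts G" using assms by (auto simp: p vwalk_def)
  have "annihilation \<mu> i (creation_basis G \<mu> i p) =
      (\<Sum>v | v \<rightarrow>\<^bsub>G\<^esub> a. Poly_Mapping.single p
        (complex_of_real (sqrt (\<mu> v / \<mu> a)) * complex_of_real (sqrt (\<mu> v / \<mu> a))))"
    unfolding p i[symmetric]
    by (simp add: creation_basis_append annihilation_basis_append annihilation_def
        linear_extension_sum)
  also have "\<dots> = (\<Sum>v | v \<rightarrow>\<^bsub>G\<^esub> a. Poly_Mapping.single p (complex_of_real (\<mu> v / \<mu> a)))"
  proof (intro sum.cong refl)
    fix v assume "v \<in> {v. v \<rightarrow>\<^bsub>G\<^esub> a}"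
    then have "0 < \<mu> v" using weight_pos adj_in_verts(1) by simp
    then have "0 \<le> \<mu> v / \<mu> a" using weight_pos[OF a] by simp
    then show "Poly_Mapping.single p
        (complex_of_real (sqrt (\<mu> v / \<mu> a)) * complex_of_real (sqrt (\<mu> v / \<mu> a))) =
      Poly_Mapping.single p (complex_of_real (\<mu> v / \<mu> a))"
      by (simp only: of_real_mult[symmetric] real_sqrt_mult_self abs_of_nonneg)
  qed
  also have "\<dots> = Poly_Mapping.single p (complex_of_real ((\<Sum>v | v \<rightarrow>\<^bsub>G\<^esub> a. \<mu> v) / \<mu> a))"
    by (simp only: sum_divide_distrib of_real_sum single_sum)
  also have "\<dots> = Poly_Mapping.single p (complex_of_real \<beta>)"
    using weight_pos[OF a] by (simp add: weight_sum[OF a])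
  finally show ?thesis using True by simp
next
  case False
  then show ?thesis by (simp add: creation_basis_out_of_range annihilation_def)
qed

text \<open>Creation turns \<open>a, b\<close> into \<open>a, v, a, b\<close>, and annihilation one
  place later keeps only \<open>v = b\<close>, which restores the path. At the last vertex there is
  no \<open>b\<close>, whence the condition on \<open>Suc i\<close>.\<close>

lemma annihilation_creation_basis_Suc:
  assumes "vwalk p G"
  shows "annihilation \<mu> (Suc i) (creation_basis G \<mu> i p) =
    Poly_Mapping.single p (if Suc i < length p then 1 else 0)"
proof (cases "Suc i < length p")
  case True
  then obtain xs a ys where p0: "p = xs @ a # ys" and i: "length xs = i"
    using split_list_at[of i p] by auto
  then obtain b zs where p: "p = xs @ a # b # zs"
    using True by (cases ys) auto
  have ab: "a \<rightarrow>\<^bsub>G\<^esub> b" using assms by (simp add: p vwalk_append_Cons_Cons)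
  have ann: "annihilation_basis \<mu> (Suc i) (xs @ a # v # a # b # zs) =
      (if v = b then Poly_Mapping.single (xs @ a # v # zs) (complex_of_real (sqrt (\<mu> a / \<mu> v))) else 0)" for v
    using annihilation_basis_append[of \<mu> "xs @ [a]" v a b zs] i by simp
  have "annihilation \<mu> (Suc i) (creation_basis G \<mu> i p) =
      (\<Sum>v | v \<rightarrow>\<^bsub>G\<^esub> a. if v = b then Poly_Mapping.single p
        (complex_of_real (sqrt (\<mu> v / \<mu> a)) * complex_of_real (sqrt (\<mu> a / \<mu> v))) else 0)"
    unfolding p i[symmetric] creation_basis_append
    using ann by (auto simp: annihilation_def linear_extension_sum i intro!: sum.cong)
  also have "\<dots> = Poly_Mapping.single p
        (complex_of_real (sqrt (\<mu> b / \<mu> a)) * complex_of_real (sqrt (\<mu> a / \<mu> b)))"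
    \<comment> \<open>The walk supplies the arc from \<open>a\<close> to \<open>b\<close>; its
      reverse puts \<open>b\<close> into the range of summation.\<close>
    using arc_sym[OF ab] by (simp add: sum.delta[OF finite_neighbours])
  also have "\<dots> = Poly_Mapping.single p 1"
    using ab by (simp only: sqrt_weight_mult adj_in_verts)
  finally show ?thesis using True by simp
next
  case False
  then show ?thesis
    by (auto simp: creation_basis_def annihilation_def linear_extension_sum
        annihilation_basis_out_of_range)
qed

text \<open>Here \<open>b, a\<close> becomes \<open>b, a, v, a\<close>, and annihilation at
  \<open>b\<close> keeps only \<open>v = b\<close>, dropping the first \<open>a\<close> and the
  inserted \<open>b\<close>.\<close>

lemma annihilation_creation_basis_pred:
  assumes "vwalk p G"
  shows "annihilation \<mu> j (creation_basis G \<mu> (Suc j) p) =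
    Poly_Mapping.single p (if Suc j < length p then 1 else 0)"
proof (cases "Suc j < length p")
  case True
  then obtain xs b ys where p0: "p = xs @ b # ys" and j: "length xs = j"
    using split_list_at[of j p] by auto
  then obtain a zs where p: "p = xs @ b # a # zs"
    using True by (cases ys) auto
  have ba: "b \<rightarrow>\<^bsub>G\<^esub> a" using assms by (simp add: p vwalk_append_Cons_Cons)
  have cre: "creation_basis G \<mu> (Suc j) p =
      (\<Sum>v | v \<rightarrow>\<^bsub>G\<^esub> a. Poly_Mapping.single (xs @ b # a # v # a # zs) (complex_of_real (sqrt (\<mu> v / \<mu> a))))"
    using creation_basis_append[of G \<mu> "xs @ [b]" a zs] j by (simp add: p)
  have "annihilation \<mu> j (creation_basis G \<mu> (Suc j) p) =
      (\<Sum>v | v \<rightarrow>\<^bsub>G\<^esub> a. if v = b then Poly_Mapping.single p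
        (complex_of_real (sqrt (\<mu> b / \<mu> a)) * complex_of_real (sqrt (\<mu> a / \<mu> b))) else 0)"
    unfolding cre unfolding j[symmetric]
    by (auto simp: annihilation_def linear_extension_sum annihilation_basis_append p
        intro!: sum.cong)
  also have "\<dots> = Poly_Mapping.single p
        (complex_of_real (sqrt (\<mu> b / \<mu> a)) * complex_of_real (sqrt (\<mu> a / \<mu> b)))"
    using ba by (simp add: sum.delta[OF finite_neighbours])
  also have "\<dots> = Poly_Mapping.single p 1"
    using ba by (simp only: sqrt_weight_mult adj_in_verts)
  finally show ?thesis using True by simp
next
  case False
  then show ?thesis by (simp add: creation_basis_out_of_range annihilation_def)
qed

section \<open>Path lengths, and creation as the adjoint of annihilation\<close>

lemma path_space_add: "\<xi> \<in> path_space G n \<Longrightarrow> \<eta> \<in> path_space G n \<Longrightarrow> \<xi> + \<eta> \<in> path_space G n"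
  using Poly_Mapping.keys_add[of \<xi> \<eta>] by (auto simp: path_space_def)

lemma path_space_scale: "\<xi> \<in> path_space G n \<Longrightarrow> scale c \<xi> \<in> path_space G n"
  by (auto simp: path_space_def in_keys_iff)

lemma path_space_zero: "0 \<in> path_space G n"
  by (simp add: path_space_def)

lemma path_space_sum:
  "(\<And>x. x \<in> A \<Longrightarrow> f x \<in> path_space G n) \<Longrightarrow> (\<Sum>x\<in>A. f x) \<in> path_space G n"
  by (induction A rule: infinite_finite_induct) (simp_all add: path_space_add path_space_zero)

lemma path_spaceD:
  assumes "\<xi> \<in> path_space G n" "p \<in> Poly_Mapping.keys \<xi>"
  shows "vwalk p G" "length p = Suc n"
proof -
  have "p \<in> elementary_paths G n" using assms by (auto simp: path_space_def)
  then show "vwalk p G" "length p = Suc n"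
    by (auto simp: elementary_paths_def vwalk_def Suc_diff_le Suc_le_eq)
qed

lemma creation_basis_in_path_space:
  assumes "vwalk p G" "length p = Suc n"
  shows "creation_basis G \<mu> i p \<in> path_space G (n + 2)"
proof (cases "i < length p")
  case True
  then obtain xs a ys where p: "p = xs @ a # ys" and i: "length xs = i"
    by (rule split_list_at)
  have walk: "vwalk (xs @ a # v # a # ys) G" if "v \<rightarrow>\<^bsub>G\<^esub> a" for v
  proof -
    have "vwalk (xs @ [a]) G \<and> vwalk (a # ys) G"
      using vwalk_appendD[of xs a ys G] assms(1) by (simp add: p)
    moreover have "vwalk (v # a # ys) G \<longleftrightarrow> vwalk [v] G \<and> v \<rightarrow>\<^bsub>G\<^esub> a \<and> vwalk (a # ys) G"
      using vwalk_append_Cons_Cons[of "[]" v a ys G] by simp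
    moreover have "vwalk [v] G" using that adj_in_verts(1) by (simp add: vwalk_def)
    ultimately show ?thesis
      using that arc_sym[OF that] by (simp add: vwalk_append_Cons_Cons)
  qed
  show ?thesis
    unfolding p i[symmetric] creation_basis_append using walk assms(2)
    by (intro path_space_sum) (auto simp: path_space_def elementary_paths_def p)
next
  case False
  then show ?thesis by (simp add: creation_basis_out_of_range path_space_zero)
qed

lemma creation_in_path_space:
  assumes "\<xi> \<in> path_space G n"
  shows "creation G \<mu> i \<xi> \<in> path_space G (n + 2)"
  unfolding creation_def linear_extension_def
proof (intro path_space_sum path_space_scale)
  fix p assume "p \<in> Poly_Mapping.keys \<xi>"
  then show "creation_basis G \<mu> i p \<in> path_space G (n + 2)"
    by (intro creation_basis_in_path_space path_spaceD[OF assms])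
qed

text \<open>Both entries equal the detour weight when \<open>q\<close> is \<open>p\<close> with a
  detour inserted at \<open>i\<close>, and vanish otherwise. As \<open>q\<close> is a walk, the
  middle vertex of a triple contracted in it is a neighbour of the first, hence among those that
  creation inserts.\<close>

lemma lookup_creation_basis:
  assumes "vwalk q G"
  shows "Poly_Mapping.lookup (creation_basis G \<mu> i p) q =
    Poly_Mapping.lookup (annihilation_basis \<mu> i q) p"
proof (cases "\<exists>v. i < length p \<and> v \<rightarrow>\<^bsub>G\<^esub> (p ! i) \<and> q = take (i + 1) p @ v # drop i p")
  case True
  then obtain v where "i < length p" and v: "v \<rightarrow>\<^bsub>G\<^esub> (p ! i)"
    and q: "q = take (i + 1) p @ v # drop i p" by blast
  then obtain xs a ys where p: "p = xs @ a # ys" and i: "length xs = i"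
    using split_list_at by metis
  have q': "q = xs @ a # v # a # ys" and va: "v \<rightarrow>\<^bsub>G\<^esub> a" using q v i by (auto simp: p)
  have "Poly_Mapping.lookup (creation_basis G \<mu> i p) q =
      (\<Sum>w | w \<rightarrow>\<^bsub>G\<^esub> a. if w = v then complex_of_real (sqrt (\<mu> v / \<mu> a)) else 0)"
    unfolding p i[symmetric] creation_basis_append q'
    by (auto simp: lookup_sum Poly_Mapping.lookup_single when_def intro!: sum.cong)
  also have "\<dots> = complex_of_real (sqrt (\<mu> v / \<mu> a))"
    using va by (simp add: sum.delta[OF finite_neighbours])
  also have "\<dots> = Poly_Mapping.lookup (annihilation_basis \<mu> i q) p"
    unfolding p i[symmetric] q' by (simp add: annihilation_basis_append)
  finally show ?thesis .
next
  case False
  then have "Poly_Mapping.lookup (creation_basis G \<mu> i p) q = 0"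
    by (auto simp: creation_basis_def lookup_sum Poly_Mapping.lookup_single when_def
        intro!: sum.neutral)
  moreover have "Poly_Mapping.lookup (annihilation_basis \<mu> i q) p = 0"
  proof (rule ccontr)
    assume nz: "Poly_Mapping.lookup (annihilation_basis \<mu> i q) p \<noteq> 0"
    then have "i + 2 < length q" by (auto simp: annihilation_basis_def split: if_splits)
    then obtain xs a b c ys where q: "q = xs @ a # b # c # ys" and i: "length xs = i"
      by (rule split_list_at_3)
    have ac: "a = c" and p: "p = xs @ a # ys"
      using nz unfolding q i[symmetric] annihilation_basis_append
      by (auto simp: Poly_Mapping.lookup_single when_def split: if_splits)
    have "b \<rightarrow>\<^bsub>G\<^esub> a"
      by (rule arc_sym) (use assms in \<open>simp add: q vwalk_append_Cons_Cons\<close>)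
    then have "i < length p \<and> b \<rightarrow>\<^bsub>G\<^esub> (p ! i) \<and> q = take (i + 1) p @ b # drop i p"
      using ac i by (simp add: p q nth_append)
    then show False using False by blast
  qed
  ultimately show ?thesis by simp
qed

lemma path_inner_creation_right:
  assumes "\<xi> \<in> path_space G n"
  shows "path_inner \<xi> (creation G \<mu> i \<eta>) = path_inner (annihilation \<mu> i \<xi>) \<eta>"
  unfolding creation_def annihilation_def
proof (rule path_inner_linear_extension_right)
  fix p q
  assume "p \<in> Poly_Mapping.keys \<xi>"
  then have "vwalk p G" using path_spaceD[OF assms] by blast
  then show "Poly_Mapping.lookup (creation_basis G \<mu> i q) p =
      cnj (Poly_Mapping.lookup (annihilation_basis \<mu> i p) q)"
    by (simp add: lookup_creation_basis annihilation_basis_def Poly_Mapping.lookup_single when_def)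
qed

text \<open>Collects the five relative positions of \<open>i\<close> and \<open>j\<close>. Only the
  form of the result is kept, because the orthogonality argument counts operators and ignores
  constants and positions.\<close>

lemma annihilation_creation_cases:
  assumes \<xi>: "\<xi> \<in> path_space G n"
  obtains (scalar) c where "annihilation \<mu> j (creation G \<mu> i \<xi>) = scale c \<xi>"
    | (commute) i' j' where
      "annihilation \<mu> j (creation G \<mu> i \<xi>) = creation G \<mu> i' (annihilation \<mu> j' \<xi>)"
proof -
  have comp: "annihilation \<mu> j (creation G \<mu> i \<xi>) =
      linear_extension (\<lambda>p. annihilation \<mu> j (creation_basis G \<mu> i p)) \<xi>"
    by (simp add: annihilation_def creation_def linear_extension_linear_extension)
  \<comment> \<open>All paths in \<open>\<xi>\<close> have \<open>Suc n\<close> vertices, so the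
    length conditions in the basis relations come out the same for each and give one scalar.\<close>
  have scalar': thesis
    if "\<And>p. vwalk p G \<Longrightarrow> length p = Suc n \<Longrightarrow>
      annihilation \<mu> j (creation_basis G \<mu> i p) = Poly_Mapping.single p c" for c
  proof (rule scalar)
    show "annihilation \<mu> j (creation G \<mu> i \<xi>) = scale c \<xi>"
      unfolding comp linear_extension_scaled_basis[symmetric]
      by (rule linear_extension_cong) (use that path_spaceD[OF \<xi>] in blast)
  qed
  consider "i + 2 \<le> j" | "j + 2 \<le> i" | "i = j" | "j = Suc i" | "i = Suc j"
    by linarith
  then show thesis
  proof cases
    case 1
    then show thesis
      by (intro commute[of i "j - 2"])
        (simp add: comp annihilation_creation_basis_right, simp add: creation_def
          annihilation_def linear_extension_linear_extension)
  next
    case 2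
    then show thesis
      by (intro commute[of "i - 2" j])
        (simp add: comp annihilation_creation_basis_left, simp add: creation_def
          annihilation_def linear_extension_linear_extension)
  next
    case 3
    then show thesis
      by (intro scalar'[of "if i < Suc n then complex_of_real \<beta> else 0"])
        (simp add: annihilation_creation_basis_same)
  next
    case 4
    then show thesis
      by (intro scalar'[of "if Suc i < Suc n then 1 else 0"])
        (simp add: annihilation_creation_basis_Suc)
  next
    case 5
    then show thesis
      by (intro scalar'[of "if Suc j < Suc n then 1 else 0"])
        (simp add: annihilation_creation_basis_pred)
  qed
qed

section \<open>Orthogonality of the layers\<close>

text \<open>Linear combinations of vectors obtained from essential paths of length \<open>m\<close>
  by \<open>k\<close> creations at arbitrary positions in arbitrary order. The increasing order in
  \<open>path_layer\<close> is given up because moving an annihilation past a creation shifts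
  positions.\<close>

inductive creation_span :: "nat \<Rightarrow> nat \<Rightarrow> 'a path_vec \<Rightarrow> bool" for m :: nat where
  essential: "\<xi> \<in> essential_paths G \<mu> m \<Longrightarrow> creation_span m 0 \<xi>"
| zero: "creation_span m k 0"
| add: "creation_span m k \<xi> \<Longrightarrow> creation_span m k \<eta> \<Longrightarrow> creation_span m k (\<xi> + \<eta>)"
| scale: "creation_span m k \<xi> \<Longrightarrow> creation_span m k (scale c \<xi>)"
| creation: "creation_span m k \<xi> \<Longrightarrow> creation_span m (Suc k) (creation G \<mu> i \<xi>)"

lemma creation_span_path_space:
  "creation_span m k \<xi> \<Longrightarrow> \<xi> \<in> path_space G (m + 2 * k)"
proof (induction rule: creation_span.induct)
  case (creation k \<xi> i)
  then show ?case using creation_in_path_space[of \<xi> "m + 2 * k" i] by simp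
qed (auto simp: essential_paths_def path_space_zero path_space_add path_space_scale)

text \<open>Extends the defining condition to all positions: for \<open>m < i + 2\<close> a path
  with \<open>Suc m\<close> vertices has no triple starting at \<open>i\<close>.\<close>

lemma annihilation_essential:
  assumes "\<xi> \<in> essential_paths G \<mu> m"
  shows "annihilation \<mu> i \<xi> = 0"
proof (cases "i + 2 \<le> m")
  case True
  then show ?thesis using assms by (simp add: essential_paths_def)
next
  case False
  have "\<xi> \<in> path_space G m" using assms by (simp add: essential_paths_def)
  then have "annihilation_basis \<mu> i p = 0" if "p \<in> Poly_Mapping.keys \<xi>" for p
    using path_spaceD(2)[of \<xi> m p] that False
    by (intro annihilation_basis_out_of_range) simp
  then show ?thesis by (simp add: annihilation_def linear_extension_def)
qed

text \<open>Annihilation either cancels the outermost creation up to a scalar or moves past it, and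
  then the induction hypothesis handles the inner vector. The \<open>case\<close> expression keeps
  level zero, where the result vanishes, inside the same induction.\<close>

lemma annihilation_creation_span:
  assumes "creation_span m k \<xi>"
  shows "case k of 0 \<Rightarrow> annihilation \<mu> j \<xi> = 0 | Suc k' \<Rightarrow> creation_span m k' (annihilation \<mu> j \<xi>)"
  using assms
proof (induction arbitrary: j rule: creation_span.induct)
  case (essential \<xi>)
  then show ?case by (simp add: annihilation_essential)
next
  case (zero k)
  then show ?case by (simp add: annihilation_def creation_span.zero split: nat.split)
next
  case (add k \<xi> \<eta>)
  from add.IH[of j] show ?case
    by (auto simp: annihilation_def linear_extension_add creation_span.add split: nat.splits)
next
  case (scale k \<xi> c)
  from scale.IH[of j] show ?case
    by (auto simp: annihilation_def linear_extension_scale creation_span.scale split: nat.splits)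
next
  case (creation k \<xi> i)
  have "creation_span m k (annihilation \<mu> j (creation G \<mu> i \<xi>))"
    using creation_span_path_space[OF creation.hyps(1)]
  proof (cases rule: annihilation_creation_cases[where i = i and j = j])
    case (scalar c)
    then show ?thesis using creation.hyps by (simp add: creation_span.scale)
  next
    case (commute i' j')
    show ?thesis
    proof (cases k)
      case 0
      \<comment> \<open>No creation is left to cancel, so the annihilation meets a combination of
        essential paths.\<close>
      then have "annihilation \<mu> j' \<xi> = 0" using creation.IH[of j'] by simp
      then show ?thesis
        using commute by (simp add: creation_def creation_span.zero)
    next
      case (Suc k')
      then have "creation_span m k' (annihilation \<mu> j' \<xi>)" using creation.IH[of j'] by simp
      then show ?thesis using commute Suc by (simp add: creation_span.creation)
    qed
  qed
  then show ?case by simp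
qed

text \<open>The outermost creation in \<open>\<eta>\<close> moves to the other side as an
  annihilation, which lowers both counts and keeps \<open>k < l\<close>. Once \<open>k\<close> is
  zero, the next annihilation makes the left argument vanish.\<close>

lemma path_inner_creation_span:
  assumes "creation_span m' l \<eta>" "creation_span m k \<xi>" "k < l"
  shows "path_inner \<xi> \<eta> = 0"
  using assms
proof (induction arbitrary: \<xi> k rule: creation_span.induct)
  case (creation l \<eta> i)
  have adj: "path_inner \<xi> (creation G \<mu> i \<eta>) = path_inner (annihilation \<mu> i \<xi>) \<eta>"
    using creation_span_path_space[OF creation.prems(1)] by (rule path_inner_creation_right)
  show ?case
  proof (cases k)
    case 0
    then have "annihilation \<mu> i \<xi> = 0"
      using annihilation_creation_span[OF creation.prems(1), of i] by simp
    then show ?thesis by (simp add: adj)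
  next
    case (Suc k')
    then have "creation_span m k' (annihilation \<mu> i \<xi>)"
      using annihilation_creation_span[OF creation.prems(1), of i] by simp
    then show ?thesis using creation.IH creation.prems(2) Suc by (simp add: adj)
  qed
next
  case (scale l \<eta> c)
  from scale.IH[OF scale.prems] show ?case
    by (simp add: path_inner_def mult.left_commute[of _ c] flip: sum_distrib_left)
\<comment> \<open>The essential case is vacuous, as \<open>k < 0\<close> is impossible.\<close>
qed (simp_all add: path_inner_add_right)

lemma creation_span_sum:
  "(\<And>x. x \<in> A \<Longrightarrow> creation_span m k (f x)) \<Longrightarrow> creation_span m k (\<Sum>x\<in>A. f x)"
  by (induction A rule: infinite_finite_induct)
    (simp_all add: creation_span.add creation_span.zero)

lemma foldr_creation_in_span:
  "\<xi> \<in> essential_paths G \<mu> m \<Longrightarrow> creation_span m (length is) (foldr (creation G \<mu>) is \<xi>)"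
  by (induction "is") (simp_all add: creation_span.essential creation_span.creation)

lemma path_layer_creation_span: "\<xi> \<in> path_layer G \<mu> n l \<Longrightarrow> creation_span (n - 2 * l) l \<xi>"
proof -
  assume "\<xi> \<in> path_layer G \<mu> n l"
  then obtain \<eta> where \<xi>: "\<xi> = (\<Sum>is\<in>creation_indices n l. \<eta> is)"
    and \<eta>: "\<forall>is\<in>creation_indices n l. \<eta> is \<in> foldr (creation G \<mu>) is ` essential_paths G \<mu> (n - 2 * l)"
    by (auto simp: path_layer_def)
  show "creation_span (n - 2 * l) l \<xi>"
    unfolding \<xi>
  proof (rule creation_span_sum)
    fix "is" assume "is": "is \<in> creation_indices n l"
    then have "length is = l" by (simp add: creation_indices_def)
    then show "creation_span (n - 2 * l) l (\<eta> is)"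
      using \<eta> "is" foldr_creation_in_span[of _ "n - 2 * l" "is"] by auto
  qed
qed

end

section \<open>The Perron-Frobenius weights\<close>

lemma (in graph) weighted_graph_perron_frobenius:
  assumes "distinct vs" "set vs = verts G" "perron_frobenius_eigenvector G vs \<beta> \<mu>"
  shows "weighted_graph G \<mu> \<beta>"
proof
  let ?A = "adjacency_matrix G vs" and ?w = "vec_of_list (map \<mu> vs)"
  fix v assume v: "v \<in> verts G"
  have "Min (\<mu> ` verts G) = 1"
    using assms by (simp add: perron_frobenius_eigenvector_def)
  \<comment> \<open>The normalisation to smallest component one yields positivity of every
    weight.\<close>
  then have "1 \<le> \<mu> v" using v Min_le[of "\<mu> ` verts G" "\<mu> v"] by simp
  then show "0 < \<mu> v" by simp
  have ev: "?A *\<^sub>v ?w = \<beta> \<cdot>\<^sub>v ?w"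
    using assms by (simp add: perron_frobenius_eigenvector_def eigenvector_def)
  obtain i where i: "i < length vs" "vs ! i = v"
    using v assms(2) by (metis in_set_conv_nth)
  have "\<beta> * \<mu> v = (\<beta> \<cdot>\<^sub>v ?w) $ i"
    using i by (simp add: vec_of_list_index)
  also have "\<dots> = (?A *\<^sub>v ?w) $ i" by (simp only: ev)
  also have "\<dots> = (\<Sum>j = 0..<length vs. if v \<rightarrow>\<^bsub>G\<^esub> vs ! j then \<mu> (vs ! j) else 0)"
    using i by (auto simp: adjacency_matrix_def scalar_prod_def vec_of_list_index intro!: sum.cong)
  also have "\<dots> = (\<Sum>w\<in>verts G. if v \<rightarrow>\<^bsub>G\<^esub> w then \<mu> w else 0)"
    using assms(1,2) by (intro sum.reindex_bij_betw bij_betw_nth) (auto simp: atLeast0LessThan)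
  also have "\<dots> = (\<Sum>w | w \<in> verts G \<and> v \<rightarrow>\<^bsub>G\<^esub> w. \<mu> w)"
    by (simp add: sum.inter_filter)
  \<comment> \<open>A matrix row runs over arcs out of \<open>v\<close>; reversing arcs gives the
    sum over arcs into \<open>v\<close>.\<close>
  also have "{w. w \<in> verts G \<and> v \<rightarrow>\<^bsub>G\<^esub> w} = {w. w \<rightarrow>\<^bsub>G\<^esub> v}"
    using arcs_ends_symmetric[OF sym_arcs] adj_in_verts by blast
  finally show "(\<Sum>w | w \<rightarrow>\<^bsub>G\<^esub> v. \<mu> w) = \<beta> * \<mu> v" by simp
qed

theorem proposition17:
  fixes G :: "('a, 'b) pre_digraph" and vs :: "'a list"
    and \<beta> :: real and \<mu> :: "'a \<Rightarrow> real" and n :: nat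
  assumes "graph G"
    and "distinct vs" and "set vs = verts G"
    and "perron_frobenius_eigenvector G vs \<beta> \<mu>"
  shows "\<forall>l \<le> n div 2. \<forall>m \<le> n div 2. l \<noteq> m \<longrightarrow>
           (\<forall>\<xi> \<in> path_layer G \<mu> n l. \<forall>\<eta> \<in> path_layer G \<mu> n m. path_inner \<xi> \<eta> = 0)"
proof -
  interpret graph G by fact
  interpret weighted_graph G \<mu> \<beta>
    using assms(2-4) by (rule weighted_graph_perron_frobenius)
  have less: "path_inner \<xi> \<eta> = 0"
    if "l < m" "\<xi> \<in> path_layer G \<mu> n l" "\<eta> \<in> path_layer G \<mu> n m" for l m \<xi> \<eta>
    using that path_inner_creation_span path_layer_creation_span by blast
  show ?thesis
  proof (intro allI impI ballI)
    fix l m \<xi> \<eta>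
    assume "l \<noteq> m" "\<xi> \<in> path_layer G \<mu> n l" "\<eta> \<in> path_layer G \<mu> n m"
    \<comment> \<open>The case \<open>m < l\<close> follows from the other one by conjugate
      symmetry.\<close>
    then show "path_inner \<xi> \<eta> = 0"
      using less[of l m \<xi> \<eta>] less[of m l \<eta> \<xi>] path_inner_commute[of \<eta> \<xi>] by (cases "l < m") auto
  qed
qed

end
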